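(* Let $k\ge 3$ be an integer. Then $W_c(k,3)>k^2$.
   Context: For positive integers $k,N,d$ with $k\ge 3$, a $k$-term cyclic arithmetic progression mod $N$ with common difference $d$ is a $k$-element subset of $\mathbb{Z}_N=\mathbb{Z}/N\mathbb{Z}$ of the form $\{t,t+d,\ldots,t+(k-1)d\}$ for some $t\in\mathbb{Z}_N$ (so these $k$ elements are pairwise distinct mod $N$). An $r$-coloring of a set $S$ is a map $c:S\to\{1,\ldots,r\}$; a subset of $S$ is monochromatic if $c$ is constant on it. For integers $k\ge 3$, $r\ge 2$, the cyclic Van der Waerden number $W_c(k,r)$ is the smallest modulus $N$ such that for all positive integers $M\ge N$ and every $r$-coloring of $\mathbb{Z}_M$, there exists a monochromatic $k$-term cyclic arithmetic progression mod $M$ in $\mathbb{Z}_M$. (This number always exists.) *)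

theory Defs
  imports Main "HOL-Library.FuncSet"
begin

text \<open>
  The ring of integers modulo $N$ is represented by its canonical residues \<open>{0..<N}\<close>, with
  arithmetic reduced \<open>mod N\<close>.
\<close>

text \<open>The cardinality condition says that the \<open>k\<close> listed terms are pairwise distinct modulo \<open>N\<close>.\<close>

definition cyclic_ap :: "nat \<Rightarrow> nat \<Rightarrow> nat \<Rightarrow> nat set \<Rightarrow> bool" where
  "cyclic_ap k N d A \<longleftrightarrow>
     card A = k \<and> (\<exists>t\<in>{0..<N}. A = (\<lambda>i. (t + i * d) mod N) ` {0..<k})"

definition coloring :: "nat \<Rightarrow> 'a set \<Rightarrow> ('a \<Rightarrow> nat) \<Rightarrow> bool" where
  "coloring r S c \<longleftrightarrow> c \<in> S \<rightarrow> {1..r}"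

definition monochromatic :: "('a \<Rightarrow> nat) \<Rightarrow> 'a set \<Rightarrow> bool" where
  "monochromatic c A \<longleftrightarrow> (\<forall>x\<in>A. \<forall>y\<in>A. c x = c y)"

text \<open>
  The least element exists by Van der Waerden's theorem; as \<open>LEAST\<close> is unspecified on an empty
  predicate, a lower bound on \<open>W_c k r\<close> depends on that existence.
\<close>

definition W_c :: "nat \<Rightarrow> nat \<Rightarrow> nat" where
  "W_c k r = (LEAST N. 0 < N \<and>
     (\<forall>M\<ge>N. \<forall>c. coloring r {0..<M} c \<longrightarrow>
        (\<exists>d>0. \<exists>A. cyclic_ap k M d A \<and> monochromatic c A)))"

end

theory Submission
  imports Defs "HOL-Library.Nat_Bijection" "HOL-Number_Theory.Cong"
begin

text \<open>
  Since \<open>W_c k 3\<close> is a \<open>LEAST\<close>, it has to be shown to exist, which is van der Waerden's theorem,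
  obtained by the colour-focusing argument.

  For the bound, write the elements of \<open>\<int>/k\<^sup>2\<close> as \<open>a k + b\<close> (row \<open>a\<close>, column \<open>b\<close>) and give each
  column a main colour: 3 for \<open>b = 0\<close>, 1 for \<open>0 < b < k/2\<close>, 2 for \<open>b \<ge> k/2\<close>. In row 0 the colours
  are changed to 1, 2 and 3 respectively. Let \<open>g = gcd d k\<close>. If \<open>g = 1\<close>, a progression with
  difference \<open>d\<close> meets every column, while each colour is missing from some column. If
  \<open>1 < g < k\<close>, it meets columns \<open>c\<close> and \<open>c + k - g\<close> for some \<open>c < g\<close>, each at least twice, so it
  contains their main colours, which differ. If \<open>g = k\<close>, it is a full column.
\<close>

section \<open>Van der Waerden's theorem\<close>

text \<open>
  The progression is \<open>t + d, \<dots>, t + k d\<close>; the term \<open>t\<close>, of unspecified colour, is included in the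
  range so that it can serve as a focus.
\<close>

definition vdw_bound :: "nat \<Rightarrow> nat set \<Rightarrow> nat \<Rightarrow> bool" where
  "vdw_bound k C N \<longleftrightarrow> (\<forall>c. c ` {..<N} \<subseteq> C \<longrightarrow>
     (\<exists>t d. 0 < d \<and> t + k * d < N \<and> (\<forall>i\<in>{1..k}. c (t + i * d) = c (t + d))))"

definition has_mono_ap :: "(nat \<Rightarrow> nat) \<Rightarrow> nat \<Rightarrow> nat \<Rightarrow> bool" where
  "has_mono_ap c k N \<longleftrightarrow> (\<exists>t d. 0 < d \<and> t + k * d < N \<and> (\<forall>i\<le>k. c (t + i * d) = c t))"

text \<open>A progression is stored as its difference alone, since all of them aim at the one focus
  \<open>f\<close>, whose own colour is left free. Injectivity makes their colours pairwise
  distinct, so \<open>card D\<close> counts colours.\<close>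

definition focused :: "(nat \<Rightarrow> nat) \<Rightarrow> nat \<Rightarrow> nat \<Rightarrow> nat \<Rightarrow> nat set \<Rightarrow> bool" where
  "focused c k N f D \<longleftrightarrow> finite D \<and> f < N \<and> inj_on (\<lambda>d. c (f + d)) D \<and>
     (\<forall>d\<in>D. 0 < d \<and> f + k * d < N \<and> (\<forall>i\<in>{1..k}. c (f + i * d) = c (f + d)))"

lemma has_mono_ap_block:
  assumes "has_mono_ap (\<lambda>y. c (x * M + y)) k M" and "x < K"
  shows "has_mono_ap c k (K * M)"
proof -
  from assms(1) obtain t d where td: "0 < d" "t + k * d < M"
    "\<And>i. i \<le> k \<Longrightarrow> c (x * M + (t + i * d)) = c (x * M + t)"
    unfolding has_mono_ap_def by auto
  have "x * M + M \<le> K * M" using mult_le_mono1[of "Suc x" K M] \<open>x < K\<close> by simp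
  hence "x * M + t + k * d < K * M" using td(2) by linarith
  thus ?thesis unfolding has_mono_ap_def using td(1,3)
    by (intro exI[of _ "x * M + t"] exI[of _ d]) (simp add: add.assoc)
qed

text \<open>Moving by \<open>d\<close> inside a block and by \<open>e\<close> blocks at once turns
  each focused progression into one aimed at the copy of \<open>f\<close> in block \<open>t\<close>.
  The copies of \<open>f\<close> in the later blocks form one more progression. Its colour is new:
  otherwise \<open>f\<close> would extend an old progression to \<open>k + 1\<close> terms.\<close>

lemma focused_blocks:
  fixes c :: "nat \<Rightarrow> nat"
  assumes "0 < k" and "0 < e" and room: "t + k * e < K"
    and blocks: "\<And>i y. i \<in> {1..k} \<Longrightarrow> y < M \<Longrightarrow> c ((t + i * e) * M + y) = c ((t + e) * M + y)"
    and foc: "focused (\<lambda>y. c ((t + e) * M + y)) k M f D"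
    and no_ap: "\<not> has_mono_ap (\<lambda>y. c ((t + e) * M + y)) k M"
  shows "focused c k (K * M) (t * M + f) (insert (e * M) ((\<lambda>d. d + e * M) ` D))"
    and "card (insert (e * M) ((\<lambda>d. d + e * M) ` D)) = Suc (card D)"
proof -
  define b where "b y = c ((t + e) * M + y)" for y
  have D: "finite D" "f < M" "inj_on (\<lambda>d. b (f + d)) D"
    "\<And>d. d \<in> D \<Longrightarrow> 0 < d" "\<And>d. d \<in> D \<Longrightarrow> f + k * d < M"
    "\<And>d i. d \<in> D \<Longrightarrow> i \<in> {1..k} \<Longrightarrow> b (f + i * d) = b (f + d)"
    using foc unfolding focused_def b_def by auto
  have "b f \<noteq> b (f + d)" if "d \<in> D" for d
  proof
    assume eq: "b f = b (f + d)"
    have "b (f + i * d) = b f" if "i \<le> k" for i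
      using D(6)[OF \<open>d \<in> D\<close>, of i] that eq by (cases "i = 0") auto
    hence "has_mono_ap b k M"
      unfolding has_mono_ap_def using D(4,5)[OF that] by blast
    thus False using no_ap by (simp add: b_def[abs_def])
  qed
  \<comment> \<open>Difference \<open>0\<close> stands for the copies of \<open>f\<close>. It
    becomes \<open>e * M > 0\<close> after translation, so old and new progressions are treated
    alike.\<close>
  hence inj0: "inj_on (\<lambda>d. b (f + d)) (insert 0 D)"
    using D(3) by (auto simp: inj_on_def) metis+
  have shift: "c (t * M + f + i * (d + e * M)) = b (f + d)"
    if "d \<in> insert 0 D" "i \<in> {1..k}" for d i
  proof -
    have "i * d \<le> k * d" using that(2) by simp
    moreover have "f + k * d < M" using D(2) D(5)[of d] that(1) by auto
    ultimately have less: "f + i * d < M" by linarith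
    \<comment> \<open>Term \<open>i\<close> lies in block \<open>t + i * e\<close> at an offset
      below \<open>M\<close>, so \<open>blocks\<close> applies.\<close>
    have "t * M + f + i * (d + e * M) = (t + i * e) * M + (f + i * d)"
      by (simp add: algebra_simps)
    hence "c (t * M + f + i * (d + e * M)) = b (f + i * d)"
      using blocks[OF that(2) less] by (simp only: b_def)
    thus ?thesis using D(6)[of d i] that by auto
  qed
  have bound: "t * M + f + k * (d + e * M) < K * M" if "d \<in> insert 0 D" for d
  proof -
    have "f + k * d < M" using D(2,5) that by auto
    moreover have "Suc (t + k * e) * M \<le> K * M" using room by (intro mult_le_mono1) simp
    ultimately show ?thesis by (simp add: algebra_simps)
  qed
  have eq: "insert (e * M) ((\<lambda>d. d + e * M) ` D) = (\<lambda>d. d + e * M) ` insert 0 D" by simp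
  have inj: "inj_on (\<lambda>d. d + e * M) (insert 0 D)" by (simp add: inj_on_def)
  have shift1: "c (t * M + f + (d + e * M)) = b (f + d)" if "d \<in> insert 0 D" for d
    using shift[OF that, of 1] \<open>0 < k\<close> by simp
  show "focused c k (K * M) (t * M + f) (insert (e * M) ((\<lambda>d. d + e * M) ` D))"
    unfolding eq focused_def
  proof (intro conjI ballI)
    show "finite ((\<lambda>d. d + e * M) ` insert 0 D)" using D(1) by simp
    show "t * M + f < K * M" using bound[of 0] by simp
    show "inj_on (\<lambda>d. c (t * M + f + d)) ((\<lambda>d. d + e * M) ` insert 0 D)"
    proof (rule inj_onI)
      fix x y assume "x \<in> (\<lambda>d. d + e * M) ` insert 0 D" "y \<in> (\<lambda>d. d + e * M) ` insert 0 D"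
        and c: "c (t * M + f + x) = c (t * M + f + y)"
      then obtain d d' where "d \<in> insert 0 D" "d' \<in> insert 0 D" "x = d + e * M" "y = d' + e * M"
        by blast
      thus "x = y" using c shift1 inj_onD[OF inj0, of d d'] by metis
    qed
  next
    fix x assume "x \<in> (\<lambda>d. d + e * M) ` insert 0 D"
    then obtain d where d: "d \<in> insert 0 D" "x = d + e * M" by blast
    show "0 < x" using d(2) \<open>0 < e\<close> D(2) by simp
    show "t * M + f + k * x < K * M" using bound[OF d(1)] d(2) by simp
    fix i assume "i \<in> {1..k}"
    thus "c (t * M + f + i * x) = c (t * M + f + x)"
      using shift[OF d(1)] shift1[OF d(1)] d(2) by simp
  qed
  show "card (insert (e * M) ((\<lambda>d. d + e * M) ` D)) = Suc (card D)"
    unfolding eq card_image[OF inj] using D(1) D(4)[of 0] card_insert_disjoint[of D 0] by blast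
qed

text \<open>Induction on the number \<open>s\<close> of colours. The patterns of blocks of length
  \<open>M\<close> form a finite palette, to which \<open>vdw\<close> is applied; hence
  \<open>vdw\<close> has to cover every finite \<open>C\<close>. The equal blocks it yields feed
  \<open>focused_blocks\<close>.\<close>

lemma focusing:
  assumes "0 < k" and vdw: "\<And>C. finite C \<Longrightarrow> \<exists>N. vdw_bound k C N" and "finite C"
  shows "\<exists>N. \<forall>c. c ` {..<N} \<subseteq> C \<longrightarrow> has_mono_ap c k N \<or> (\<exists>f D. focused c k N f D \<and> card D = s)"
proof (induction s)
  case 0
  \<comment> \<open>Length 1 rather than 0, because even without progressions the focus must lie
    below \<open>N\<close>.\<close>
  have "focused c k 1 0 {}" for c by (simp add: focused_def)
  thus ?case by (intro exI[of _ 1]) force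
next
  case (Suc s)
  then obtain M where M: "\<And>c. c ` {..<M} \<subseteq> C \<Longrightarrow>
    has_mono_ap c k M \<or> (\<exists>f D. focused c k M f D \<and> card D = s)" by blast
  define C' where "C' = list_encode ` {xs. set xs \<subseteq> C \<and> length xs = M}"
  have "finite C'" unfolding C'_def using finite_lists_length_eq[OF \<open>finite C\<close>] by simp
  then obtain K where K: "vdw_bound k C' K" using vdw by blast
  show ?case
  proof (intro exI[of _ "K * M"] allI impI)
    fix c :: "nat \<Rightarrow> nat" assume c: "c ` {..<K * M} \<subseteq> C"
    \<comment> \<open>Colours are natural numbers in \<open>vdw_bound\<close>; the injective
      \<open>list_encode\<close> makes a block's pattern into one.\<close>
    define B where "B x = list_encode (map (\<lambda>y. c (x * M + y)) [0..<M])" for x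
    have less: "x * M + y < K * M" if "x < K" "y < M" for x y
      using mult_le_mono1[of "Suc x" K M] that by simp
    have "B ` {..<K} \<subseteq> C'"
    proof
      fix z assume "z \<in> B ` {..<K}"
      then obtain x where x: "x < K" "z = B x" by blast
      have "set (map (\<lambda>y. c (x * M + y)) [0..<M]) \<subseteq> C"
        using less[OF x(1)] c by auto
      thus "z \<in> C'" unfolding x(2) C'_def B_def by (intro imageI CollectI conjI) simp_all
    qed
    then have "\<exists>t e. 0 < e \<and> t + k * e < K \<and> (\<forall>i\<in>{1..k}. B (t + i * e) = B (t + e))"
      using K unfolding vdw_bound_def by simp
    then obtain t e where te: "0 < e" "t + k * e < K" "\<And>i. i \<in> {1..k} \<Longrightarrow> B (t + i * e) = B (t + e)"
      by blast
    have blocks: "c ((t + i * e) * M + y) = c ((t + e) * M + y)" if "i \<in> {1..k}" "y < M" for i y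
      using te(3)[OF that(1)] that(2) by (auto simp: B_def list_encode_eq)
    have "e \<le> k * e" using \<open>0 < k\<close> by simp
    hence "t + e < K" using te(2) by linarith
    hence "(\<lambda>y. c ((t + e) * M + y)) ` {..<M} \<subseteq> C" using less[OF \<open>t + e < K\<close>] c by auto
    from M[OF this] have "has_mono_ap (\<lambda>y. c ((t + e) * M + y)) k M \<or>
      \<not> has_mono_ap (\<lambda>y. c ((t + e) * M + y)) k M \<and>
      (\<exists>f D. focused (\<lambda>y. c ((t + e) * M + y)) k M f D \<and> card D = s)" by blast
    thus "has_mono_ap c k (K * M) \<or> (\<exists>f D. focused c k (K * M) f D \<and> card D = Suc s)"
    proof (elim disjE conjE exE)
      assume "has_mono_ap (\<lambda>y. c ((t + e) * M + y)) k M"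
      thus ?thesis using has_mono_ap_block[OF _ \<open>t + e < K\<close>] by blast
    next
      fix f D
      assume "\<not> has_mono_ap (\<lambda>y. c ((t + e) * M + y)) k M"
        "focused (\<lambda>y. c ((t + e) * M + y)) k M f D" "card D = s"
      thus ?thesis using focused_blocks[OF \<open>0 < k\<close> te(1,2) blocks] by blast
    qed
  qed
qed

text \<open>Induction on the number of terms: focused progressions in \<open>card C + 1\<close>
  colours cannot exist, so focusing must produce a progression with one more term.\<close>

theorem van_der_Waerden: "finite C \<Longrightarrow> \<exists>N. vdw_bound (Suc k) C N"
proof (induction k arbitrary: C)
  case 0
  have "vdw_bound (Suc 0) C 2"
    unfolding vdw_bound_def by (intro allI impI exI[of _ 0] exI[of _ 1]) simp
  thus ?case by blast
next
  case (Suc k)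
  obtain N where N: "\<And>c. c ` {..<N} \<subseteq> C \<Longrightarrow>
      has_mono_ap c (Suc k) N \<or> (\<exists>f D. focused c (Suc k) N f D \<and> card D = Suc (card C))"
    using focusing[OF _ Suc.IH Suc.prems, of "Suc (card C)"] by blast
  have ap: "has_mono_ap c (Suc k) N" if c: "c ` {..<N} \<subseteq> C" for c
  proof (rule ccontr)
    assume "\<not> has_mono_ap c (Suc k) N"
    then obtain f D where fD: "focused c (Suc k) N f D" "card D = Suc (card C)"
      using N[OF c] by blast
    have "f + d < N" if "d \<in> D" for d
    proof -
      have "f + Suc k * d < N" using fD(1) that unfolding focused_def by blast
      thus ?thesis by simp
    qed
    hence "(\<lambda>d. c (f + d)) ` D \<subseteq> C" using c by auto
    moreover have "inj_on (\<lambda>d. c (f + d)) D" using fD(1) unfolding focused_def by blast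
    ultimately have "card D \<le> card C" using card_inj_on_le Suc.prems by blast
    thus False using fD(2) by simp
  qed
  \<comment> \<open>The \<open>t\<close> of \<open>vdw_bound\<close> lies one difference before the
    first coloured term. Searching the upper half leaves room to subtract \<open>d\<close>.\<close>
  have "vdw_bound (Suc (Suc k)) C (N + N)"
    unfolding vdw_bound_def
  proof (intro allI impI)
    fix c assume c: "c ` {..<N + N} \<subseteq> C"
    have "(\<lambda>x. c (N + x)) ` {..<N} \<subseteq> C" using c by auto
    from ap[OF this] obtain t d where td: "0 < d" "t + Suc k * d < N"
      "\<And>i. i \<le> Suc k \<Longrightarrow> c (N + (t + i * d)) = c (N + t)"
      unfolding has_mono_ap_def by blast
    have "d \<le> N" using td(2) by simp
    have step: "N + t - d + i * d = N + (t + (i - 1) * d)" if "i \<in> {1..Suc (Suc k)}" for i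
      using \<open>d \<le> N\<close> that by (cases i) auto
    have "c (N + t - d + i * d) = c (N + t)" if "i \<in> {1..Suc (Suc k)}" for i
      using td(3)[of "i - 1"] step[OF that] that by auto
    moreover have "c (N + t - d + d) = c (N + t)" using \<open>d \<le> N\<close> by simp
    moreover have "N + t - d + Suc (Suc k) * d < N + N"
      using step[of "Suc (Suc k)"] td(2) by simp
    ultimately show "\<exists>t d. 0 < d \<and> t + Suc (Suc k) * d < N + N \<and>
        (\<forall>i\<in>{1..Suc (Suc k)}. c (t + i * d) = c (t + d))"
      using td(1) by (intro exI[of _ "N + t - d"] exI[of _ d]) auto
  qed
  thus ?case by blast
qed

text \<open>A progression inside \<open>{..<N}\<close> does not wrap around modulo \<open>M\<close>
  when \<open>N <= M\<close>, so it is cyclic with distinct terms.\<close>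

lemma ex_cyclic_vdw_bound:
  assumes "0 < k"
  shows "\<exists>N. 0 < N \<and> (\<forall>M\<ge>N. \<forall>c. coloring r {0..<M} c \<longrightarrow>
    (\<exists>d>0. \<exists>A. cyclic_ap k M d A \<and> monochromatic c A))"
proof -
  obtain N where N: "vdw_bound k {1..r} N"
    using van_der_Waerden[of "{1..r}" "k - 1"] assms by auto
  have "\<exists>d>0. \<exists>A. cyclic_ap k M d A \<and> monochromatic c A"
    if "N \<le> M" and c: "coloring r {0..<M} c" for M c
  proof -
    have "c ` {..<N} \<subseteq> {1..r}" using c \<open>N \<le> M\<close> by (auto simp: coloring_def Pi_iff)
    then have "\<exists>t d. 0 < d \<and> t + k * d < N \<and> (\<forall>i\<in>{1..k}. c (t + i * d) = c (t + d))"
      using N unfolding vdw_bound_def by simp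
    then obtain t d where td: "0 < d" "t + k * d < N"
      "\<And>i. i \<in> {1..k} \<Longrightarrow> c (t + i * d) = c (t + d)"
      by blast
    define A where "A = (\<lambda>i. (t + d + i * d) mod M) ` {0..<k}"
    have small: "t + d + i * d < M" if "i < k" for i
    proof -
      have "Suc i * d \<le> k * d" using that by (intro mult_le_mono1) simp
      thus ?thesis using td(2) \<open>N \<le> M\<close> by simp
    qed
    hence A: "A = (\<lambda>i. t + d + i * d) ` {0..<k}" unfolding A_def by (intro image_cong) auto
    have "inj_on (\<lambda>i. t + d + i * d) {0..<k}" using td(1) by (simp add: inj_on_def)
    hence "card A = k" unfolding A by (simp add: card_image)
    moreover have "t + d \<in> {0..<M}" using small[of 0] assms by simp
    ultimately have "cyclic_ap k M d A" unfolding cyclic_ap_def A_def by blast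
    moreover have "c (t + d + i * d) = c (t + d)" if "i < k" for i
      using td(3)[of "Suc i"] that by (simp add: add.assoc)
    hence "monochromatic c A" unfolding monochromatic_def A by auto
    ultimately show ?thesis using td(1) by blast
  qed
  moreover have "0 < N" using N unfolding vdw_bound_def
    by (cases "N = 0") auto
  ultimately show ?thesis by blast
qed

section \<open>The lower bound\<close>

definition column_coloring :: "nat \<Rightarrow> nat \<Rightarrow> nat" where
  "column_coloring k x =
     (if x < k then (if x mod k = 0 then 1 else if 2 * (x mod k) < k then 2 else 3)
      else (if x mod k = 0 then 3 else if 2 * (x mod k) < k then 1 else 2))"

text \<open>Bezout gives an integer index \<open>u * w\<close>. It may be reduced modulo
  \<open>k div g\<close>, since \<open>(k div g) * d\<close> is a multiple of
  \<open>k\<close>.\<close>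

lemma ap_meets_residue:
  fixes t d k b :: nat
  assumes "0 < k" and "[t = b] (mod gcd d k)"
  obtains i where "i < k div gcd d k" and "[t + i * d = b] (mod k)"
proof -
  define g where "g = gcd d k"
  have g: "0 < g" "g dvd d" "g dvd k" using assms(1) by (simp_all add: g_def)
  have "int g dvd int b - int t"
    using assms(2) by (metis cong_iff_dvd_diff cong_int_iff cong_sym g_def)
  moreover obtain u v where "u * int d + v * int k = int g"
    using bezout_int[of "int d" "int k"] by (auto simp: g_def)
  ultimately obtain w where w: "int b - int t = (u * int d + v * int k) * w" by (metis dvdE)
  define m where "m = int (k div g)"
  have m: "0 < m" using g assms(1) by (simp add: m_def div_greater_zero_iff dvd_imp_le)
  define i where "i = nat ((u * w) mod m)"
  have i: "int i = (u * w) mod m" using m by (simp add: i_def)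
  have "int k dvd m * int d"
  proof -
    have "k dvd k div g * d"
      using g by (metis div_mult_swap dvd_div_mult dvd_triv_left mult.commute)
    thus ?thesis by (simp add: m_def flip: of_nat_mult)
  qed
  moreover have "int t + int i * int d - int b = - (m * int d) * ((u * w) div m) - int k * (v * w)"
  proof -
    have "int i = u * w - m * ((u * w) div m)" unfolding i by (simp add: minus_mult_div_eq_mod)
    hence "int i * int d = (u * w - m * ((u * w) div m)) * int d" by simp
    thus ?thesis using w by (simp add: algebra_simps)
  qed
  ultimately have "int k dvd int t + int i * int d - int b" by simp
  hence "[int (t + i * d) = int b] (mod int k)" by (simp add: cong_iff_dvd_diff)
  hence "[t + i * d = b] (mod k)" using cong_int_iff by blast
  moreover have "int i < m" using i m by simp
  hence "i < k div g" by (simp add: m_def)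
  ultimately show thesis using that by (simp add: g_def)
qed

lemma no_mono_cyclic_ap:
  assumes k: "3 \<le> k" and ap: "cyclic_ap k (k\<^sup>2) d A"
  shows "\<not> monochromatic (column_coloring k) A"
proof
  assume mono: "monochromatic (column_coloring k) A"
  obtain t where cardA: "card A = k" and A: "A = (\<lambda>i. (t + i * d) mod k\<^sup>2) ` {0..<k}"
    using ap unfolding cyclic_ap_def by blast
  define p where "p i = (t + i * d) mod k\<^sup>2" for i
  have pA: "p i \<in> A" if "i < k" for i using that by (auto simp: A p_def)
  have inj: "inj_on p {0..<k}"
    using cardA by (intro eq_card_imp_inj_on) (simp_all add: A p_def[abs_def])
  \<comment> \<open>Reduction modulo \<open>k^2\<close> preserves columns, as \<open>k\<close>
    divides \<open>k^2\<close>.\<close>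
  have pmod: "p i mod k = (t + i * d) mod k" for i
    by (simp add: p_def power2_eq_square mod_mult2_eq)
  define g where "g = gcd d k"
  have g: "0 < g" "g dvd d" "g dvd k" "g \<le> k"
    using k by (simp_all add: g_def dvd_imp_le)
  obtain q where q: "k = g * q" using g(3) by auto
  have meets: "\<exists>i<q. p i mod k = b mod k" if "t mod g = b mod g" for b
  proof -
    have "0 < k" "[t = b] (mod gcd d k)" using k that by (simp_all add: g_def cong_def)
    from ap_meets_residue[OF this] obtain i where "i < k div g" "[t + i * d = b] (mod k)"
      unfolding g_def .
    moreover have "k div g = q" using q g(1) by simp
    ultimately show ?thesis using pmod by (auto simp: cong_def)
  qed
  define c where "c = t mod g"
  have c: "c < g" using g(1) by (simp add: c_def)
  consider "g = 1" | "1 < g" "g < k" | "g = k" using g(1,4) by linarith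
  thus False
  proof cases
    case 1
    have "\<exists>x\<in>A. x mod k = b" if "b < k" for b
      using meets[of b] 1 q pA that by auto
    \<comment> \<open>Columns 0, 1 and \<open>k - 1\<close> lack the colours 2, 3 and 1
      respectively; column 1 is in the first half because \<open>k >= 3\<close>.\<close>
    from this[of 0] this[of 1] this[of "k - 1"] k obtain x y z where
      xyz: "x \<in> A" "y \<in> A" "z \<in> A" "x mod k = 0" "y mod k = 1" "z mod k = k - 1" by auto
    have "column_coloring k x \<noteq> 2" "column_coloring k y \<noteq> 3" "column_coloring k z \<noteq> 1"
      "column_coloring k x \<in> {1, 2, 3}"
      using k xyz by (auto simp: column_coloring_def)
    thus False using mono xyz(1-3) unfolding monochromatic_def by (metis empty_iff insert_iff)
  next
    case 2
    have "q \<noteq> 0" "q \<noteq> 1" using q 2 by auto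
    hence q2: "2 \<le> q" by linarith
    \<comment> \<open>The first bound keeps the index \<open>i + q\<close> below \<open>k\<close>;
      the second puts columns \<open>c\<close> and \<open>c + (k - g)\<close> in different
      halves.\<close>
    have gq: "2 * q \<le> k" "2 * g \<le> k" unfolding q
      using mult_le_mono1[of 2 g q] mult_le_mono2[of 2 q g] 2 q2 by auto
    \<comment> \<open>A column met at index \<open>i < q\<close> is met again at index \<open>i + q\<close>, and at most one of the two
      elements lies in row 0.\<close>
    have main: "\<exists>x\<in>A. k \<le> x \<and> x mod k = b mod k" if b: "t mod g = b mod g" for b
    proof -
      obtain i where i: "i < q" "p i mod k = b mod k" using meets[OF b] by blast
      have "k dvd q * d" using g(2) q by (auto simp: dvd_def)
      hence "(t + i * d + q * d) mod k = (t + i * d) mod k"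
        by (metis add.right_neutral dvd_eq_mod_eq_0 mod_add_right_eq)
      hence i2: "p (i + q) mod k = b mod k"
        using i(2) by (simp add: pmod algebra_simps)
      have lt: "i < k" "i + q < k" using i(1) gq(1) by auto
      hence ne: "p i \<noteq> p (i + q)" using inj_onD[OF inj, of i "i + q"] q2 by auto
      have "k \<le> p i \<or> k \<le> p (i + q)"
      proof (rule ccontr)
        assume "\<not> ?thesis"
        hence "p i = p (i + q)" using i(2) i2 by simp
        thus False using ne by simp
      qed
      thus ?thesis using i(2) i2 pA lt by blast
    qed
    obtain x where x: "x \<in> A" "k \<le> x" "x mod k = c"
      using main[of c] c g(4) by (auto simp: c_def)
    have "g dvd k - g" using g(3) by simp
    hence "(c + (k - g)) mod g = c mod g"
      by (metis add.right_neutral dvd_eq_mod_eq_0 mod_add_right_eq)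
    hence "t mod g = (c + (k - g)) mod g" by (simp add: c_def)
    then obtain y where y: "y \<in> A" "k \<le> y" "y mod k = c + (k - g)"
      using main[of "c + (k - g)"] c g(4) by auto
    have "column_coloring k x \<noteq> 2" "column_coloring k y = 2"
      using x y c gq 2 by (auto simp: column_coloring_def)
    thus False using mono x(1) y(1) unfolding monochromatic_def by metis
  next
    case 3
    have "k dvd d" using g(2) 3 by simp
    \<comment> \<open>\<open>L\<close> is the whole column \<open>c\<close>. It contains
      \<open>A\<close> and has at most \<open>k = card A\<close> elements, so the two
      coincide.\<close>
    define L where "L = (\<lambda>a. c + a * k) ` {0..<k}"
    have "A \<subseteq> L"
    proof
      fix x assume "x \<in> A"
      then obtain i where x: "x = p i" by (auto simp: A p_def)
      have "x mod k = c" using x pmod[of i] \<open>k dvd d\<close> 3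
        by (metis c_def add.right_neutral dvd_eq_mod_eq_0 dvd_mult mod_add_right_eq)
      hence "x = c + (x div k) * k" by (metis add.commute div_mult_mod_eq)
      moreover have "x < k * k" using k by (simp add: x p_def power2_eq_square)
      hence "x div k < k" by (simp add: less_mult_imp_div_less)
      ultimately show "x \<in> L" unfolding L_def by (metis atLeastLessThan_iff image_eqI le0)
    qed
    moreover have "card L \<le> card A" using card_image_le[of "{0..<k}"] by (simp add: L_def cardA)
    moreover have "finite L" by (simp add: L_def)
    ultimately have "A = L" by (metis card_seteq)
    have "c + a * k \<in> L" if "a < k" for a
      using that by (simp add: L_def)
    \<comment> \<open>These two elements share a column, but only the first lies in the recoloured
      row 0.\<close>
    from this[of 0] this[of 1] have "c \<in> A" "c + k \<in> A" using k \<open>A = L\<close> by auto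
    moreover have "column_coloring k c \<noteq> column_coloring k (c + k)"
      using c 3 by (simp add: column_coloring_def)
    ultimately show False using mono unfolding monochromatic_def by metis
  qed
qed

theorem proposition4p7:
  fixes k :: nat
  assumes "k \<ge> 3"
  shows "W_c k 3 > k^2"
proof (rule ccontr)
  assume "\<not> W_c k 3 > k\<^sup>2"
  \<comment> \<open>By existence the \<open>LEAST\<close> satisfies its own condition, which then
    covers the modulus \<open>k^2\<close>.\<close>
  moreover have "\<forall>M\<ge>W_c k 3. \<forall>c. coloring 3 {0..<M} c \<longrightarrow>
      (\<exists>d>0. \<exists>A. cyclic_ap k M d A \<and> monochromatic c A)"
    unfolding W_c_def using LeastI_ex[OF ex_cyclic_vdw_bound[of k 3]] assms by simp
  moreover have "coloring 3 {0..<k\<^sup>2} (column_coloring k)"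
    by (simp add: coloring_def column_coloring_def)
  ultimately show False using no_mono_cyclic_ap[OF assms] by (meson not_less)
qed

end
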